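(* Let $(\mathcal{X}, \mathcal{S}, \mu)$ be a probability space and let $\mathcal{C} \subseteq \mathcal{S}$ be any family of measurable sets. Then either (i) $\mathcal{C}$ is finitely approximable (with respect to $\mu$), or (ii) $\mathcal{C}$ has infinite VC dimension. (The two alternatives are not claimed to be mutually exclusive.)
   Context: VC dimension: a family $\mathcal{C}$ of subsets of $\mathcal{X}$ shatters a finite set $D \subseteq \mathcal{X}$ if $|\{C \cap D : C \in \mathcal{C}\}| = 2^{|D|}$, i.e. every subset of $D$ is of the form $C \cap D$ with $C \in \mathcal{C}$. The Vapnik-Chervonenkis (VC) dimension $\dim(\mathcal{C})$ is the largest integer $k$ such that $\mathcal{C}$ shatters some set of cardinality $k$; $\dim(\mathcal{C}) = +\infty$ if $\mathcal{C}$ shatters arbitrarily large finite sets. $\pi$-boundary: for a finite measurable partition $\pi$ of $\mathcal{X}$ and a set $C \in \mathcal{C}$, the $\pi$-boundary of $C$ is $$\partial(C : \pi) = \bigcup \{ A \in \pi : \mu(A \cap C) \cdot \mu(A \cap C^c) > 0 \}.$$ Finitely approximable: $\mathcal{C}$ is finitely approximable (with respect to $\mu$) if for every $\epsilon > 0$ there exists a finite measurable partition $\pi$ of $\mathcal{X}$ such that $\mu(\partial(C : \pi)) \leq \epsilon$ for every $C \in \mathcal{C}$. *)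

theory Defs
  imports "HOL-Probability.Probability"
begin

definition shatters :: "'a set set \<Rightarrow> 'a set \<Rightarrow> bool" where
  "shatters \<C> D \<longleftrightarrow> finite D \<and> card {C \<inter> D | C. C \<in> \<C>} = 2 ^ card D"

(* The supremum in enat is the maximum when the cardinalities are bounded and \<infinity> when they
   are not.  The empty family, which shatters nothing, gets dimension 0. *)
definition vc_dim :: "'a set \<Rightarrow> 'a set set \<Rightarrow> enat" where
  "vc_dim X \<C> = Sup {enat (card D) | D. D \<subseteq> X \<and> shatters \<C> D}"

(* partition_on excludes the empty set as a cell; such a cell would not contribute to any
   boundary. *)
definition finite_measurable_partition :: "'a measure \<Rightarrow> 'a set set \<Rightarrow> bool" where
  "finite_measurable_partition M \<pi> \<longleftrightarrow> finite \<pi> \<and> \<pi> \<subseteq> sets M \<and> partition_on (space M) \<pi>"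

(* Real-valued measure is used here and below, so M is meant to be a finite measure. *)
definition partition_boundary :: "'a measure \<Rightarrow> 'a set \<Rightarrow> 'a set set \<Rightarrow> 'a set" where
  "partition_boundary M C \<pi> =
     \<Union> {A \<in> \<pi>. measure M (A \<inter> C) * measure M (A \<inter> (space M - C)) > 0}"

definition finitely_approximable :: "'a measure \<Rightarrow> 'a set set \<Rightarrow> bool" where
  "finitely_approximable M \<C> \<longleftrightarrow>
     (\<forall>\<epsilon>>0. \<exists>\<pi>. finite_measurable_partition M \<pi> \<and>
        (\<forall>C\<in>\<C>. measure M (partition_boundary M C \<pi>) \<le> \<epsilon>))"

end

theory Submission
  imports Defs
begin

text \<open>
  Suppose that the family fails to be approximable for some \<open>\<epsilon>\<close>. Every finite measurable partition
  \<open>\<pi>\<close> then has a boundary \<open>\<partial>(C : \<pi>)\<close> of measure at least \<open>\<epsilon>\<close>. By Tychonoff's theorem the set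
  functions \<open>A \<mapsto> \<mu>(A \<inter> \<partial>(C : \<pi>))\<close> have a cluster point \<open>\<nu> \<le> \<mu>\<close> as \<open>\<pi>\<close> is refined. It is additive
  and has total mass at least \<open>\<epsilon>\<close>. Let \<open>B\<close> be the complement of a maximal \<open>\<nu>\<close>-null set. Any finitely
  many nonnull subsets of \<open>B\<close> have positive \<open>\<nu>\<close>-measure, so they all meet one boundary
  \<open>\<partial>(C : \<pi>)\<close> with \<open>\<pi>\<close> finer than each of them, and hence are all split by the same \<open>C\<close>. Splitting
  \<open>B\<close> repeatedly yields arbitrarily many members of the family all of whose Boolean atoms are
  nonempty. Taking \<open>2\<^sup>k\<close> of them, indexed by the subsets of a \<open>k\<close>-element set, gives \<open>k\<close> shattered
  points by duality.
\<close>

section \<open>Splitting of sets and finitely generated partitions\<close>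

definition splits :: "'a measure \<Rightarrow> 'a set \<Rightarrow> 'a set \<Rightarrow> bool" where
  "splits M C A \<longleftrightarrow> measure M (A \<inter> C) > 0 \<and> measure M (A - C) > 0"

lemma (in finite_measure) splits_mono:
  assumes "splits M C A" "A \<subseteq> A'" "A' \<in> sets M" "C \<in> sets M"
  shows "splits M C A'"
proof -
  have "measure M (A \<inter> C) \<le> measure M (A' \<inter> C)" "measure M (A - C) \<le> measure M (A' - C)"
    using assms by (auto intro!: finite_measure_mono)
  then show ?thesis
    using assms(1) unfolding splits_def by linarith
qed

text \<open>The atom of the algebra generated by \<open>\<A>\<close> with membership pattern
  \<open>I\<close>. It is empty for patterns that no point realises, which is why \<open>{}\<close>
  is removed below.\<close>

definition atom :: "'a measure \<Rightarrow> 'a set set \<Rightarrow> 'a set set \<Rightarrow> 'a set" where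
  "atom M \<A> I = {x \<in> space M. \<forall>A\<in>\<A>. x \<in> A \<longleftrightarrow> A \<in> I}"

lemma sets_atom:
  assumes "finite \<A>" "\<A> \<subseteq> sets M"
  shows "atom M \<A> I \<in> sets M"
  unfolding atom_def
proof (rule sets.sets_Collect_finite_All[OF _ assms(1)])
  fix A assume "A \<in> \<A>"
  then have A: "A \<in> sets M" using assms by auto
  have "{x \<in> space M. (x \<in> A) = (A \<in> I)} = (if A \<in> I then A else space M - A)"
    using sets.sets_into_space[OF A] by auto
  then show "{x \<in> space M. (x \<in> A) = (A \<in> I)} \<in> sets M" using A by auto
qed

lemma finite_measurable_partition_atoms:
  assumes "finite \<A>" "\<A> \<subseteq> sets M"
  shows "finite_measurable_partition M (atom M \<A> ` Pow \<A> - {{}})"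
  unfolding finite_measurable_partition_def
proof (intro conjI)
  show "finite (atom M \<A> ` Pow \<A> - {{}})" using assms by auto
  show "atom M \<A> ` Pow \<A> - {{}} \<subseteq> sets M" using sets_atom[OF assms] by auto
  show "partition_on (space M) (atom M \<A> ` Pow \<A> - {{}})"
  proof (rule partition_onI)
    show "\<Union> (atom M \<A> ` Pow \<A> - {{}}) = space M"
    proof (intro antisym subsetI)
      fix x assume "x \<in> space M"
      then have "x \<in> atom M \<A> {A \<in> \<A>. x \<in> A}" by (auto simp: atom_def)
      moreover have "{A \<in> \<A>. x \<in> A} \<in> Pow \<A>" by auto
      ultimately show "x \<in> \<Union> (atom M \<A> ` Pow \<A> - {{}})" by blast
    qed (auto simp: atom_def)
    show "disjnt p q"
      if pq: "p \<in> atom M \<A> ` Pow \<A> - {{}}" "q \<in> atom M \<A> ` Pow \<A> - {{}}" and "p \<noteq> q" for p q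
    proof -
      obtain I J where IJ: "I \<subseteq> \<A>" "J \<subseteq> \<A>" "p = atom M \<A> I" "q = atom M \<A> J"
        using pq by blast
      with \<open>p \<noteq> q\<close> have "I \<noteq> J" by auto
      with IJ obtain A where "A \<in> \<A>" "A \<in> I \<longleftrightarrow> A \<notin> J" by blast
      then show ?thesis unfolding disjnt_def IJ atom_def by blast
    qed
  qed auto
qed

text \<open>Take the partition into atoms of \<open>\<A>\<close> and let \<open>B\<close> be a large
  boundary of some \<open>C\<close>. A boundary cell that meets a member \<open>A\<close> of
  \<open>\<A>\<close> lies inside \<open>A\<close>; since \<open>C\<close> splits the cell, it
  splits \<open>A\<close>.\<close>

lemma (in prob_space) boundary_splits:
  assumes \<C>: "\<C> \<subseteq> sets M"
    and bad: "\<And>\<pi>. finite_measurable_partition M \<pi> \<Longrightarrow>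
               \<exists>C\<in>\<C>. measure M (partition_boundary M C \<pi>) > \<epsilon>"
    and \<A>: "finite \<A>" "\<A> \<subseteq> sets M"
  shows "\<exists>B\<in>sets M. measure M B \<ge> \<epsilon> \<and>
           (\<exists>C\<in>\<C>. \<forall>A\<in>\<A>. measure M (A \<inter> B) > 0 \<longrightarrow> splits M C A)"
proof -
  define \<pi> where "\<pi> = atom M \<A> ` Pow \<A> - {{}}"
  have \<pi>: "finite_measurable_partition M \<pi>"
    unfolding \<pi>_def by (rule finite_measurable_partition_atoms[OF \<A>])
  obtain C where C: "C \<in> \<C>" "measure M (partition_boundary M C \<pi>) > \<epsilon>"
    using bad[OF \<pi>] by auto
  have CM: "C \<in> sets M" using C \<C> by auto
  define B where "B = partition_boundary M C \<pi>"
  have B: "B \<in> sets M"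
    unfolding B_def partition_boundary_def
    using \<pi> by (intro sets.finite_Union) (auto simp: finite_measurable_partition_def)
  have "splits M C A" if A: "A \<in> \<A>" "measure M (A \<inter> B) > 0" for A
  proof -
    obtain x where x: "x \<in> A" "x \<in> B"
      using A(2) by (metis Int_iff all_not_in_conv less_irrefl measure_empty)
    obtain P where P: "x \<in> P" "P \<in> \<pi>"
      "measure M (P \<inter> C) * measure M (P \<inter> (space M - C)) > 0"
      using x(2) by (auto simp: B_def partition_boundary_def)
    have "P \<subseteq> A" using P(1,2) x(1) A(1) by (auto simp: \<pi>_def atom_def)
    have "P \<inter> (space M - C) = P - C"
      using P(2) by (auto simp: \<pi>_def atom_def)
    then have "splits M C P"
      using P(3) measure_nonneg[of M "P \<inter> C"] measure_nonneg[of M "P - C"]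
      by (auto simp: splits_def zero_less_mult_iff)
    then show ?thesis
      using splits_mono \<open>P \<subseteq> A\<close> A(1) \<A>(2) CM by blast
  qed
  then show ?thesis using B C unfolding B_def by (meson less_imp_le)
qed

section \<open>The limit content and its null sets\<close>

text \<open>Compactness of a product of unit intervals gives a point \<open>\<nu>\<close> in all
  closures \<open>closure (T \<A>)\<close>. Closed conditions pass from the functions in
  \<open>T \<A>\<close> to \<open>\<nu>\<close>, and open conditions on \<open>\<nu>\<close> are
  already met by some function in \<open>T \<A>\<close>.\<close>

lemma (in prob_space) exists_limit_content:
  fixes R :: "'a set set \<Rightarrow> 'a set \<Rightarrow> bool"
  assumes ex: "\<And>\<A>. finite \<A> \<Longrightarrow> \<A> \<subseteq> sets M \<Longrightarrow> \<exists>B\<in>sets M. measure M B \<ge> \<epsilon> \<and> R \<A> B"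
    and anti: "\<And>\<A> \<A>' B. \<A> \<subseteq> \<A>' \<Longrightarrow> R \<A>' B \<Longrightarrow> R \<A> B"
  obtains \<nu> :: "'a set \<Rightarrow> real"
  where "\<And>A. 0 \<le> \<nu> A"
    and "\<And>A. A \<in> sets M \<Longrightarrow> \<nu> A \<le> measure M A"
    and "\<And>A A'. A \<in> sets M \<Longrightarrow> A' \<in> sets M \<Longrightarrow> A \<inter> A' = {} \<Longrightarrow> \<nu> (A \<union> A') = \<nu> A + \<nu> A'"
    and "\<nu> (space M) \<ge> \<epsilon>"
    and "\<And>\<A>. finite \<A> \<Longrightarrow> \<A> \<subseteq> sets M \<Longrightarrow> (\<And>A. A \<in> \<A> \<Longrightarrow> \<nu> A > 0) \<Longrightarrow>
           \<exists>B. R \<A> B \<and> (\<forall>A\<in>\<A>. measure M (A \<inter> B) > 0)"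
proof -
  define T :: "'a set set \<Rightarrow> ('a set \<Rightarrow> real) set"
    where "T \<A> = {\<lambda>A. measure M (A \<inter> B) | B. B \<in> sets M \<and> measure M B \<ge> \<epsilon> \<and> R \<A> B}" for \<A>
  \<comment> \<open>The coordinates are all subsets, measurable or not; \<open>measure M\<close>
    takes values in [0,1] on each of them.\<close>
  define K :: "('a set \<Rightarrow> real) set" where "K = PiE UNIV (\<lambda>_. {0..1})"
  have "compactin (product_topology (\<lambda>_. euclidean) UNIV) K"
    unfolding K_def compactin_PiE by auto
  then have K: "compact K" by (simp add: euclidean_product_topology)
  have TK: "T \<A> \<subseteq> K" for \<A> by (auto simp: T_def K_def)
  let ?I = "{\<A>. finite \<A> \<and> \<A> \<subseteq> sets M}"
  have "K \<inter> (\<Inter>\<A>\<in>?I. closure (T \<A>)) \<noteq> {}"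
  proof (rule compact_imp_fip_image[OF K])
    fix I' assume I': "finite I'" "I' \<subseteq> ?I"
    \<comment> \<open>By \<open>anti\<close>, a set \<open>B\<close> found for the union of the
      finitely many families works for each of them.\<close>
    have "finite (\<Union>I')" "\<Union>I' \<subseteq> sets M" using I' by auto
    from ex[OF this] obtain B where B: "B \<in> sets M" "measure M B \<ge> \<epsilon>" "R (\<Union>I') B" by auto
    have "(\<lambda>A. measure M (A \<inter> B)) \<in> T \<A>" if "\<A> \<in> I'" for \<A>
      using B anti[of \<A> "\<Union>I'" B] that by (auto simp: T_def)
    moreover have "(\<lambda>A. measure M (A \<inter> B)) \<in> K" by (auto simp: K_def)
    ultimately show "K \<inter> (\<Inter>\<A>\<in>I'. closure (T \<A>)) \<noteq> {}"
      using closure_subset by blast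
  qed auto
  then obtain \<nu> where \<nu>K: "\<nu> \<in> K" and \<nu>: "\<And>\<A>. \<A> \<in> ?I \<Longrightarrow> \<nu> \<in> closure (T \<A>)" by auto
  \<comment> \<open>The conditions needed here do not involve \<open>R\<close>, so membership in the
    closure of \<open>T {}\<close> is enough.\<close>
  have closedP: "P \<nu>" if "closed {f. P f}"
    "\<And>B. B \<in> sets M \<Longrightarrow> measure M B \<ge> \<epsilon> \<Longrightarrow> P (\<lambda>A. measure M (A \<inter> B))" for P
  proof -
    have "T {} \<subseteq> {f. P f}" using that(2) by (auto simp: T_def)
    from closure_minimal[OF this that(1)] \<nu>[of "{}"] show ?thesis by auto
  qed
  note coord = continuous_on_product_coordinates
  show thesis
  proof (rule that[of \<nu>])
    show "0 \<le> \<nu> A" for A using \<nu>K by (auto simp: K_def PiE_def Pi_def)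
    show "\<nu> A \<le> measure M A" if "A \<in> sets M" for A
      by (rule closedP) (auto intro!: closed_Collect_le continuous_intros coord finite_measure_mono that)
    show "\<nu> (A \<union> A') = \<nu> A + \<nu> A'" if "A \<in> sets M" "A' \<in> sets M" "A \<inter> A' = {}" for A A'
    proof (rule closedP)
      show "closed {f :: 'a set \<Rightarrow> real. f (A \<union> A') = f A + f A'}"
        by (intro closed_Collect_eq continuous_intros coord)
      fix B assume "B \<in> sets M"
      have "(A \<inter> B) \<inter> (A' \<inter> B) = {}" using that by auto
      then show "measure M ((A \<union> A') \<inter> B) = measure M (A \<inter> B) + measure M (A' \<inter> B)"
        using that \<open>B \<in> sets M\<close> by (simp add: Int_Un_distrib2 finite_measure_Union)
    qed
    show "\<nu> (space M) \<ge> \<epsilon>"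
      by (rule closedP) (auto intro!: closed_Collect_le continuous_intros coord
          simp: sets.Int_space_eq1)
    fix \<A> assume \<A>: "finite \<A>" "\<A> \<subseteq> sets M" "\<And>A. A \<in> \<A> \<Longrightarrow> \<nu> A > 0"
    \<comment> \<open>Finitely many strict inequalities on coordinates are an open condition in the
      product topology.\<close>
    have "open (\<Inter>A\<in>\<A>. {f :: 'a set \<Rightarrow> real. 0 < f A})"
      using \<A>(1) by (intro open_INT ballI open_Collect_less continuous_intros coord)
    moreover have "\<nu> \<in> (\<Inter>A\<in>\<A>. {f. 0 < f A}) \<inter> closure (T \<A>)"
      using \<A> \<nu>[of \<A>] by auto
    ultimately have "(\<Inter>A\<in>\<A>. {f. 0 < f A}) \<inter> T \<A> \<noteq> {}"
      using open_Int_closure_eq_empty by blast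
    then show "\<exists>B. R \<A> B \<and> (\<forall>A\<in>\<A>. measure M (A \<inter> B) > 0)" by (auto simp: T_def)
  qed
qed

text \<open>Exhaustion: some \<nu>-null set attains the supremum \<open>s\<close> of the measures of
  \<nu>-null sets. As \<open>\<nu>\<close> is only finitely additive, the countable union of null
  sets is null because \<open>measure M\<close> dominates \<open>\<nu>\<close>.\<close>

lemma (in prob_space) exists_maximal_null_set:
  fixes \<nu> :: "'a set \<Rightarrow> real"
  assumes nn: "\<And>A. 0 \<le> \<nu> A"
    and le: "\<And>A. A \<in> sets M \<Longrightarrow> \<nu> A \<le> measure M A"
    and add: "\<And>A A'. A \<in> sets M \<Longrightarrow> A' \<in> sets M \<Longrightarrow> A \<inter> A' = {} \<Longrightarrow> \<nu> (A \<union> A') = \<nu> A + \<nu> A'"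
  obtains N where "N \<in> sets M" "\<nu> N = 0"
    "\<And>A. A \<in> sets M \<Longrightarrow> A \<inter> N = {} \<Longrightarrow> \<nu> A = 0 \<Longrightarrow> measure M A = 0"
proof -
  define \<Z> where "\<Z> = {N \<in> sets M. \<nu> N = 0}"
  have empty: "{} \<in> \<Z>" using nn[of "{}"] le[of "{}"] by (auto simp: \<Z>_def)
  have diff: "A - A' \<in> \<Z>" if "A \<in> \<Z>" "A' \<in> sets M" for A A'
  proof -
    have "\<nu> ((A - A') \<union> (A \<inter> A')) = \<nu> (A - A') + \<nu> (A \<inter> A')"
      using that by (intro add) (auto simp: \<Z>_def)
    then show ?thesis
      using that nn[of "A - A'"] nn[of "A \<inter> A'"] by (auto simp: \<Z>_def Un_Diff_Int)
  qed
  have un: "A \<union> A' \<in> \<Z>" if "A \<in> \<Z>" "A' \<in> \<Z>" for A A'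
  proof -
    have "\<nu> (A \<union> (A' - A)) = \<nu> A + \<nu> (A' - A)"
      using that by (intro add) (auto simp: \<Z>_def)
    then show ?thesis
      using that diff[of A' A] by (auto simp: \<Z>_def)
  qed
  define s where "s = Sup (measure M ` \<Z>)"
  have bdd: "bdd_above (measure M ` \<Z>)" by (rule bdd_aboveI[of _ 1]) auto
  have "\<exists>N\<in>\<Z>. s - 1 / Suc n < measure M N" for n :: nat
    using less_cSup_iff[of "measure M ` \<Z>" "s - 1 / Suc n"] bdd empty
    unfolding s_def by auto
  then obtain F where F: "\<And>n. F n \<in> \<Z>" "\<And>n::nat. s - 1 / Suc n < measure M (F n)" by metis
  define G where "G n = (\<Union>i\<le>n. F i)" for n
  have G: "G n \<in> \<Z>" for n
  proof (induction n)
    case 0 then show ?case using F by (simp add: G_def)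
  next
    case (Suc n)
    have "G (Suc n) = G n \<union> F (Suc n)" by (auto simp: G_def le_Suc_eq)
    then show ?case using un Suc F by auto
  qed
  have GM: "G n \<in> sets M" for n using G by (auto simp: \<Z>_def)
  have incG: "incseq G" unfolding G_def by (intro incseq_SucI UN_mono) auto
  define N where "N = (\<Union>n. G n)"
  have NM: "N \<in> sets M" unfolding N_def using GM by auto
  have lim: "(\<lambda>n. measure M (G n)) \<longlonglongrightarrow> measure M N"
    unfolding N_def using GM incG by (intro finite_Lim_measure_incseq) auto
  \<comment> \<open>Since \<open>G n\<close> is null, only \<open>N - G n\<close> contributes to
    \<open>\<nu> N\<close>, and its measure tends to 0.\<close>
  have "\<nu> N \<le> measure M N - measure M (G n)" for n
  proof -
    have sub: "G n \<subseteq> N" by (auto simp: N_def)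
    have "\<nu> (G n \<union> (N - G n)) = \<nu> (G n) + \<nu> (N - G n)" using GM NM by (intro add) auto
    moreover have "G n \<union> (N - G n) = N" using sub by auto
    moreover have "\<nu> (G n) = 0" using G[of n] by (simp add: \<Z>_def)
    moreover have "\<nu> (N - G n) \<le> measure M (N - G n)" using GM NM by (intro le) auto
    moreover have "measure M (N - G n) = measure M N - measure M (G n)"
      using GM NM sub by (intro finite_measure_Diff) auto
    ultimately show ?thesis by simp
  qed
  moreover have "(\<lambda>n. measure M N - measure M (G n)) \<longlonglongrightarrow> measure M N - measure M N"
    by (intro tendsto_intros lim)
  ultimately have "\<nu> N \<le> 0"
    using LIMSEQ_le_const[of _ "measure M N - measure M N" "\<nu> N"] by auto
  then have N0: "\<nu> N = 0" using nn[of N] by simp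
  have "s - 1 / Suc n \<le> measure M N" for n
  proof -
    have "measure M (F n) \<le> measure M N"
      using NM by (intro finite_measure_mono) (auto simp: N_def G_def)
    then show ?thesis using F(2)[of n] by simp
  qed
  moreover have "(\<lambda>n. s - 1 / real (Suc n)) \<longlonglongrightarrow> s - 0"
    by (intro tendsto_diff tendsto_const LIMSEQ_Suc[OF lim_1_over_n])
  ultimately have s: "s \<le> measure M N"
    using LIMSEQ_le_const2[of "\<lambda>n. s - 1 / real (Suc n)" s "measure M N"] by auto
  show thesis
  proof (rule that[OF NM N0])
    fix A assume A: "A \<in> sets M" "A \<inter> N = {}" "\<nu> A = 0"
    \<comment> \<open>Joining to \<open>N\<close> a disjoint null set of positive measure would
      exceed \<open>s\<close>.\<close>
    have "A \<union> N \<in> \<Z>" using un[of A N] A NM N0 by (auto simp: \<Z>_def)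
    then have "measure M (A \<union> N) \<le> s" unfolding s_def using bdd by (intro cSup_upper) auto
    moreover have "measure M (A \<union> N) = measure M A + measure M N"
      using A NM by (intro finite_measure_Union) auto
    ultimately show "measure M A = 0" using s measure_nonneg[of M A] by linarith
  qed
qed

text \<open>\<open>B\<close> is the complement of a maximal \<nu>-null set, so its subsets of
  positive measure have positive \<open>\<nu>\<close>. The limit content then provides one boundary
  meeting finitely many of them in positive measure.\<close>

lemma (in prob_space) exists_uniformly_split_set:
  assumes \<C>: "\<C> \<subseteq> sets M" and "\<epsilon> > 0"
    and bad: "\<And>\<pi>. finite_measurable_partition M \<pi> \<Longrightarrow>
               \<exists>C\<in>\<C>. measure M (partition_boundary M C \<pi>) > \<epsilon>"
  obtains B where "B \<in> sets M" "measure M B > 0"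
    "\<And>\<A>. finite \<A> \<Longrightarrow> \<A> \<subseteq> sets M \<Longrightarrow> (\<And>A. A \<in> \<A> \<Longrightarrow> A \<subseteq> B \<and> measure M A > 0) \<Longrightarrow>
       \<exists>C\<in>\<C>. \<forall>A\<in>\<A>. splits M C A"
proof -
  let ?R = "\<lambda>\<A> B. \<exists>C\<in>\<C>. \<forall>A\<in>\<A>. measure M (A \<inter> B) > 0 \<longrightarrow> splits M C A"
  obtain \<nu> :: "'a set \<Rightarrow> real"
    where nn: "\<And>A. 0 \<le> \<nu> A"
    and le: "\<And>A. A \<in> sets M \<Longrightarrow> \<nu> A \<le> measure M A"
    and add: "\<And>A A'. A \<in> sets M \<Longrightarrow> A' \<in> sets M \<Longrightarrow> A \<inter> A' = {} \<Longrightarrow> \<nu> (A \<union> A') = \<nu> A + \<nu> A'"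
    and tot: "\<nu> (space M) \<ge> \<epsilon>"
    and pos: "\<And>\<A>. finite \<A> \<Longrightarrow> \<A> \<subseteq> sets M \<Longrightarrow> (\<And>A. A \<in> \<A> \<Longrightarrow> \<nu> A > 0) \<Longrightarrow>
           \<exists>B. ?R \<A> B \<and> (\<forall>A\<in>\<A>. measure M (A \<inter> B) > 0)"
  proof (rule exists_limit_content[of \<epsilon> ?R])
    show "\<exists>B\<in>sets M. measure M B \<ge> \<epsilon> \<and> ?R \<A> B" if "finite \<A>" "\<A> \<subseteq> sets M" for \<A>
      by (rule boundary_splits[OF \<C> bad that])
  qed blast+
  obtain N where N: "N \<in> sets M" "\<nu> N = 0"
    "\<And>A. A \<in> sets M \<Longrightarrow> A \<inter> N = {} \<Longrightarrow> \<nu> A = 0 \<Longrightarrow> measure M A = 0"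
    using exists_maximal_null_set[OF nn le add] by blast
  show thesis
  proof (rule that[of "space M - N"])
    show "space M - N \<in> sets M" using N by auto
    have "\<nu> (N \<union> (space M - N)) = \<nu> N + \<nu> (space M - N)" using N by (intro add) auto
    moreover have "N \<union> (space M - N) = space M" using sets.sets_into_space[OF N(1)] by auto
    ultimately show "measure M (space M - N) > 0"
      using N tot \<open>\<epsilon> > 0\<close> le[of "space M - N"] by auto
    fix \<A> assume \<A>: "finite \<A>" "\<A> \<subseteq> sets M"
      "\<And>A. A \<in> \<A> \<Longrightarrow> A \<subseteq> space M - N \<and> measure M A > 0"
    have "\<nu> A > 0" if "A \<in> \<A>" for A
    proof -
      have "A \<inter> N = {}" "measure M A \<noteq> 0" "A \<in> sets M" using \<A> that by force+
      then show ?thesis using N(3)[of A] nn[of A] by force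
    qed
    from pos[OF \<A>(1,2) this] show "\<exists>C\<in>\<C>. \<forall>A\<in>\<A>. splits M C A" by blast
  qed
qed

section \<open>Independent sets and shattering by duality\<close>

text \<open>Induction on \<open>J\<close>: the atoms inside \<open>B\<close> built so far have
  positive measure, so a single new member of \<open>\<C>\<close> splits them all, and both halves
  of each serve as the new atoms.\<close>

lemma (in prob_space) exists_independent_sets:
  fixes J :: "'b set"
  assumes \<C>: "\<C> \<subseteq> sets M" and B: "B \<in> sets M" "measure M B > 0"
    and split: "\<And>\<A>. finite \<A> \<Longrightarrow> \<A> \<subseteq> sets M \<Longrightarrow>
      (\<And>A. A \<in> \<A> \<Longrightarrow> A \<subseteq> B \<and> measure M A > 0) \<Longrightarrow> \<exists>C\<in>\<C>. \<forall>A\<in>\<A>. splits M C A"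
    and "finite J"
  shows "\<exists>C. C ` J \<subseteq> \<C> \<and>
    (\<forall>I\<subseteq>J. {x \<in> B. \<forall>j\<in>J. x \<in> C j \<longleftrightarrow> j \<in> I} \<in> sets M \<and>
      measure M {x \<in> B. \<forall>j\<in>J. x \<in> C j \<longleftrightarrow> j \<in> I} > 0)"
  using \<open>finite J\<close>
proof (induction J)
  case empty
  then show ?case using B by auto
next
  case (insert k J)
  then obtain C where C: "C ` J \<subseteq> \<C>"
    and at: "\<And>I. I \<subseteq> J \<Longrightarrow> {x \<in> B. \<forall>j\<in>J. x \<in> C j \<longleftrightarrow> j \<in> I} \<in> sets M"
      "\<And>I. I \<subseteq> J \<Longrightarrow> measure M {x \<in> B. \<forall>j\<in>J. x \<in> C j \<longleftrightarrow> j \<in> I} > 0"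
    by auto
  define E where "E I = {x \<in> B. \<forall>j\<in>J. x \<in> C j \<longleftrightarrow> j \<in> I}" for I
  have "\<exists>D\<in>\<C>. \<forall>A\<in>E ` Pow J. splits M D A"
    using at insert.hyps by (intro split) (auto simp: E_def)
  then obtain D where D: "D \<in> \<C>" "\<And>I. I \<subseteq> J \<Longrightarrow> splits M D (E I)" by auto
  have DM: "D \<in> sets M" using D \<C> by auto
  let ?C = "C(k := D)"
  have "{x \<in> B. \<forall>j\<in>insert k J. x \<in> ?C j \<longleftrightarrow> j \<in> I} \<in> sets M \<and>
      measure M {x \<in> B. \<forall>j\<in>insert k J. x \<in> ?C j \<longleftrightarrow> j \<in> I} > 0"
    if "I \<subseteq> insert k J" for I
  proof -
    have "I - {k} \<subseteq> J" using that by auto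
    then have "E (I - {k}) \<in> sets M" "splits M D (E (I - {k}))"
      using at(1) D(2) unfolding E_def by blast+
    moreover have eq: "{x \<in> B. \<forall>j\<in>insert k J. x \<in> ?C j \<longleftrightarrow> j \<in> I} =
        (if k \<in> I then E (I - {k}) \<inter> D else E (I - {k}) - D)"
      using insert.hyps by (auto simp: E_def)
    ultimately show ?thesis unfolding eq using DM by (auto simp: splits_def)
  qed
  moreover have "?C ` insert k J \<subseteq> \<C>" using C D insert.hyps by auto
  ultimately show ?case by blast
qed

lemma shatters_of_dual_independent:
  fixes C :: "'b set \<Rightarrow> 'a set"
  assumes K: "finite K" and C: "C ` Pow K \<subseteq> \<C>"
    and x: "\<And>i S. i \<in> K \<Longrightarrow> S \<subseteq> K \<Longrightarrow> x i \<in> C S \<longleftrightarrow> i \<in> S"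
  shows "shatters \<C> (x ` K)" "card (x ` K) = card K"
proof -
  have inj: "inj_on x K"
  proof (rule inj_onI)
    fix i i' assume i: "i \<in> K" "i' \<in> K" "x i = x i'"
    then have "{i} \<subseteq> K" by simp
    then have "i' \<in> {i}" using i x by (metis singletonI)
    then show "i = i'" by simp
  qed
  then show "card (x ` K) = card K" by (rule card_image)
  have "{A \<inter> x ` K | A. A \<in> \<C>} = Pow (x ` K)"
  proof (intro antisym subsetI)
    fix Y assume "Y \<in> Pow (x ` K)"
    then obtain S where S: "S \<subseteq> K" "Y = x ` S" by (auto simp: subset_image_iff)
    have iff: "x i \<in> C S \<longleftrightarrow> i \<in> S" if "i \<in> K" for i by (rule x[OF that S(1)])
    have "C S \<inter> x ` K = x ` {i \<in> K. x i \<in> C S}" by blast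
    also have "{i \<in> K. x i \<in> C S} = S" using S(1) iff by blast
    finally have "Y = C S \<inter> x ` K" using S(2) by simp
    moreover have "C S \<in> \<C>" using C S(1) by blast
    ultimately show "Y \<in> {A \<inter> x ` K | A. A \<in> \<C>}" by blast
  qed auto
  then show "shatters \<C> (x ` K)"
    unfolding shatters_def using K by (simp add: card_Pow)
qed

theorem theorem1:
  fixes M :: "'a measure" and \<C> :: "'a set set"
  assumes "prob_space M" and "\<C> \<subseteq> sets M"
  shows "finitely_approximable M \<C> \<or> vc_dim (space M) \<C> = \<infinity>"
  unfolding disj_imp
proof
  assume "\<not> finitely_approximable M \<C>"
  then obtain \<epsilon> where \<epsilon>: "\<epsilon> > 0" "\<And>\<pi>. finite_measurable_partition M \<pi> \<Longrightarrow>
      \<exists>C\<in>\<C>. measure M (partition_boundary M C \<pi>) > \<epsilon>"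
    unfolding finitely_approximable_def by (meson not_le)
  interpret prob_space M by fact
  obtain B where B: "B \<in> sets M" "measure M B > 0"
    "\<And>\<A>. finite \<A> \<Longrightarrow> \<A> \<subseteq> sets M \<Longrightarrow> (\<And>A. A \<in> \<A> \<Longrightarrow> A \<subseteq> B \<and> measure M A > 0) \<Longrightarrow>
       \<exists>C\<in>\<C>. \<forall>A\<in>\<A>. splits M C A"
    using exists_uniformly_split_set[OF assms(2) \<epsilon>] by blast
  have "enat k \<le> vc_dim (space M) \<C>" for k
  proof -
    let ?K = "{..<k}"
    have "finite (Pow ?K)" by simp
    from exists_independent_sets[OF assms(2) B this]
    obtain C where C: "C ` Pow ?K \<subseteq> \<C>"
      and pos: "\<And>I. I \<subseteq> Pow ?K \<Longrightarrow> measure M {x \<in> B. \<forall>S\<in>Pow ?K. x \<in> C S \<longleftrightarrow> S \<in> I} > 0"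
      by blast
    have "\<exists>x\<in>B. \<forall>S\<in>Pow ?K. x \<in> C S \<longleftrightarrow> i \<in> S" for i
    proof -
      \<comment> \<open>The point for \<open>i\<close> is taken from the atom whose pattern consists
        of the index sets containing \<open>i\<close>; for \<open>i \<ge> k\<close> this pattern is
        empty.\<close>
      have "measure M {x \<in> B. \<forall>S\<in>Pow ?K. x \<in> C S \<longleftrightarrow> S \<in> {S \<in> Pow ?K. i \<in> S}} > 0"
        by (rule pos) auto
      then have "{x \<in> B. \<forall>S\<in>Pow ?K. x \<in> C S \<longleftrightarrow> S \<in> {S \<in> Pow ?K. i \<in> S}} \<noteq> {}"
        by (metis less_irrefl measure_empty)
      then show ?thesis by blast
    qed
    then obtain x where x: "\<And>i. x i \<in> B" "\<And>i S. S \<subseteq> ?K \<Longrightarrow> x i \<in> C S \<longleftrightarrow> i \<in> S"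
      by (metis PowI)
    have "shatters \<C> (x ` ?K)" "card (x ` ?K) = k"
      using shatters_of_dual_independent[of ?K C \<C> x] C x(2) by auto
    moreover have "x ` ?K \<subseteq> space M"
      using x(1) sets.sets_into_space[OF B(1)] by auto
    ultimately show ?thesis
      unfolding vc_dim_def by (intro Sup_upper CollectI exI[of _ "x ` ?K"]) auto
  qed
  \<comment> \<open>A finite value \<open>n\<close> would contradict the bound for
    \<open>Suc n\<close>.\<close>
  then show "vc_dim (space M) \<C> = \<infinity>"
    using enat_ord_simps(1) not_less_eq_eq by (metis not_infinity_eq order_refl)
qed

end
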